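(* Let $n\ge2$, let $v'\in\mathbb{V}(n-1)$ have canonical representative $x'$, and let $v\in\mathbb{V}(n)$ be its rightmost child. Let $x$ be the canonical representative of $v$. Then $$x\equiv x'\pmod{2^{\kappa(n)}}.$$ Moreover, put $r:=\sigma_n-\kappa(n)$. Then $r\in\{2,3\}$, and there is a unique $\lambda\in\{1,3,\ldots,2^r-1\}$ (odd integers from $1$ to $2^r-1$) such that $$x\equiv x'+\lambda 2^{\kappa(n)}\pmod{2^{\sigma_n}}.$$
   Context: Let $\kappa(n)=\lfloor n\log_2 3\rfloor$ for $n\ge1$ and $\sigma_n=\lfloor 1+(n+1)\log_2 3\rfloor=\kappa(n+1)+1$. For $n\ge1$ let $\mathcal{A}_n$ be the set of integer vectors $\boldsymbol{\alpha}=(\alpha_1,\ldots,\alpha_{n+1})$ with $0=\alpha_1<\cdots<\alpha_{n+1}$ and $\alpha_{i+1}\le\kappa(i)$ for $1\le i\le n$. For $\boldsymbol{\alpha}\in\mathcal{A}_n$ let $v(\boldsymbol{\alpha})\in\{0,1\}^{\kappa(n)+1}$ be the vector (positions indexed $0,\ldots,\kappa(n)$) with ones precisely at positions $\alpha_1,\ldots,\alpha_{n+1}$, and $\mathbb{V}(n)=\{v(\boldsymbol{\alpha}):\boldsymbol{\alpha}\in\mathcal{A}_n\}$. Let $T:\mathbb{Z}\to\mathbb{Z}$ be $T(x)=x/2$ for even $x$ and $T(x)=(3x+1)/2$ for odd $x$. The parity vector of length $L$ of an integer $x$ has entry $1$ at position $s$ ($0\le s\le L-1$) iff $T^s(x)$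 is odd; it depends only on $x$ mod $2^L$ and gives a bijection $\mathbb{Z}/2^L\mathbb{Z}\to\{0,1\}^L$. The canonical representative of $v(\boldsymbol{\alpha})\in\mathbb{V}(n)$ is the unique $x\in\{1,\ldots,2^{\sigma_n}-1\}$ whose parity vector of length $\sigma_n$ has ones precisely at positions $\alpha_1,\ldots,\alpha_{n+1}$. For $n\ge2$, the rightmost child of $v(\alpha_1,\ldots,\alpha_n)\in\mathbb{V}(n-1)$ is $v(\alpha_1,\ldots,\alpha_n,\kappa(n))\in\mathbb{V}(n)$, i.e. the parent is extended by zeros to length $\kappa(n)+1$ and a $1$ is placed at position $\kappa(n)$. *)

theory Defs
  imports Complex_Main "HOL-Number_Theory.Cong"
begin

definition kappa :: "nat \<Rightarrow> nat" where
  "kappa n = nat \<lfloor>real n * log 2 3\<rfloor>"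

definition sigma :: "nat \<Rightarrow> nat" where
  "sigma n = nat \<lfloor>1 + real (n + 1) * log 2 3\<rfloor>"

text \<open>
  Lists are indexed from 0, so the entry \<open>\<alpha> ! i\<close> is the component with index \<open>i + 1\<close>
  of the vector \<open>(\<alpha>\<^sub>1, \<dots>, \<alpha>\<^sub>n\<^sub>+\<^sub>1)\<close>. The entries are natural numbers because they
  increase from 0.
\<close>

definition adm_vectors :: "nat \<Rightarrow> nat list set" where
  "adm_vectors n = {\<alpha>. length \<alpha> = n + 1 \<and> \<alpha> ! 0 = 0 \<and> sorted_wrt (<) \<alpha> \<and>
     (\<forall>i\<in>{1..n}. \<alpha> ! i \<le> kappa i)}"

definition bit_vector :: "nat \<Rightarrow> nat list \<Rightarrow> nat list" where
  "bit_vector n \<alpha> = map (\<lambda>s. if s \<in> set \<alpha> then 1 else 0) [0..<kappa n + 1]"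

definition VV :: "nat \<Rightarrow> nat list set" where
  "VV n = bit_vector n ` adm_vectors n"

definition T :: "int \<Rightarrow> int" where
  "T x = (if even x then x div 2 else (3 * x + 1) div 2)"

definition parity_vector :: "nat \<Rightarrow> int \<Rightarrow> nat list" where
  "parity_vector L x = map (\<lambda>s. if odd ((T ^^ s) x) then 1 else 0) [0..<L]"

definition ones :: "nat list \<Rightarrow> nat set" where
  "ones w = {s. s < length w \<and> w ! s = 1}"

definition canonical_rep :: "nat \<Rightarrow> nat list \<Rightarrow> int" where
  "canonical_rep n v =
     (THE x. x \<in> {1..2 ^ sigma n - 1} \<and> ones (parity_vector (sigma n) x) = ones v)"

text \<open>
  The parent, a vector in \<open>VV (n - 1)\<close>, is extended by zeros up to position
  \<open>kappa n - 1\<close>, and a one is placed at position \<open>kappa n\<close>.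
\<close>

definition rightmost_child :: "nat \<Rightarrow> nat list \<Rightarrow> nat list" where
  "rightmost_child n v = v @ replicate (kappa n - length v) 0 @ [1]"

lemma kappa_less: "kappa n < kappa (Suc n)"
proof -
  have l: "log 2 (3::real) \<ge> 1" by simp
  have "\<lfloor>real n * log 2 3\<rfloor> + 1 = \<lfloor>real n * log 2 3 + 1\<rfloor>" by simp
  also have "\<dots> \<le> \<lfloor>real (Suc n) * log 2 3\<rfloor>"
    using l by (intro floor_mono) (simp add: algebra_simps)
  finally have "\<lfloor>real n * log 2 3\<rfloor> < \<lfloor>real (Suc n) * log 2 3\<rfloor>" by linarith
  moreover have "0 \<le> \<lfloor>real n * log 2 3\<rfloor>" using l by simp
  ultimately show ?thesis unfolding kappa_def by (simp only: nat_less_eq_zless)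
qed

lemma sigma_eq: "sigma n = kappa (n + 1) + 1"
proof -
  have "0 \<le> real (n + 1) * log 2 3" by simp
  hence "0 \<le> \<lfloor>real (n + 1) * log 2 3\<rfloor>" by (simp only: zero_le_floor)
  moreover have "\<lfloor>1 + real (n + 1) * log 2 3\<rfloor> = \<lfloor>real (n + 1) * log 2 3\<rfloor> + 1"
    by linarith
  ultimately show ?thesis unfolding sigma_def kappa_def by (simp add: nat_add_distrib)
qed

lemma adm_vectors_append_kappa:
  assumes "\<alpha> \<in> adm_vectors n"
  shows "\<alpha> @ [kappa (Suc n)] \<in> adm_vectors (Suc n)"
    and "set \<alpha> \<subseteq> {..kappa n}"
proof -
  have len: "length \<alpha> = n + 1" and z: "\<alpha> ! 0 = 0" and s: "sorted_wrt (<) \<alpha>"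
    and b: "\<And>i. i \<in> {1..n} \<Longrightarrow> \<alpha> ! i \<le> kappa i"
    using assms unfolding adm_vectors_def by auto
  have mono: "kappa i \<le> kappa n" if "i \<le> n" for i
    by (rule lift_Suc_mono_le[OF _ that]) (use kappa_less in \<open>simp add: less_imp_le\<close>)
  have le: "\<alpha> ! i \<le> kappa n" if "i \<le> n" for i
  proof (cases "i = 0")
    case False
    thus ?thesis using b[of i] mono[of i] that by simp
  qed (simp add: z)
  show sub: "set \<alpha> \<subseteq> {..kappa n}"
    using le len by (auto simp: in_set_conv_nth)
  have "\<forall>i\<in>{1..Suc n}. (\<alpha> @ [kappa (Suc n)]) ! i \<le> kappa i"
    using b len by (auto simp: nth_append not_less le_less_Suc_eq)
  moreover have "sorted_wrt (<) (\<alpha> @ [kappa (Suc n)])"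
    using s sub kappa_less[of n] by (fastforce simp: sorted_wrt_append)
  ultimately show "\<alpha> @ [kappa (Suc n)] \<in> adm_vectors (Suc n)"
    unfolding adm_vectors_def using len z by (simp add: nth_append)
qed

lemma rightmost_child_bit_vector:
  assumes "n \<ge> 1" and "\<alpha> \<in> adm_vectors (n - 1)"
  shows "rightmost_child n (bit_vector (n - 1) \<alpha>) = bit_vector n (\<alpha> @ [kappa n])"
proof -
  obtain m where m: "n = Suc m" using assms(1) by (cases n) auto
  have sub: "set \<alpha> \<subseteq> {..kappa m}"
    using adm_vectors_append_kappa(2) assms(2) m by simp
  have l: "kappa m < kappa n" using kappa_less m by simp
  show ?thesis
    unfolding rightmost_child_def bit_vector_def using sub l m
    by (intro nth_equalityI) (auto simp: nth_append less_Suc_eq simp del: upt_Suc)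
qed

lemma rightmost_child_in_VV:
  assumes "n \<ge> 1" and "v \<in> VV (n - 1)"
  shows "rightmost_child n v \<in> VV n"
proof -
  obtain \<alpha> where a: "\<alpha> \<in> adm_vectors (n - 1)" "v = bit_vector (n - 1) \<alpha>"
    using assms(2) unfolding VV_def by auto
  have "\<alpha> @ [kappa n] \<in> adm_vectors n"
    using adm_vectors_append_kappa(1)[OF a(1)] assms(1) by simp
  thus ?thesis
    using rightmost_child_bit_vector[OF assms(1) a(1)] a(2) unfolding VV_def by simp
qed

end

theory Submission
  imports Defs
begin

text \<open>
  Adding \<open>a * 2 ^ k\<close> to \<open>x\<close> changes \<open>(T ^^ k) x\<close> by \<open>a\<close> times a power of 3
  (\<open>T_funpow_shift\<close>). Since that power is odd, the first \<open>L\<close> parities determine, and are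
  determined by, the residue modulo \<open>2 ^ L\<close> (\<open>same_parities_iff_dvd\<close>), and every parity
  pattern occurs (\<open>parities_surj\<close>); hence canonical representatives really have the
  prescribed parities (\<open>canonical_rep_spec\<close>).

  The representative \<open>x'\<close> of the parent is determined by its parities at the positions
  \<open>0, \<dots>, \<kappa>(n)\<close>, because \<open>\<sigma>\<^sub>n\<^sub>-\<^sub>1 = \<kappa>(n) + 1\<close>; the last of these positions carries a zero.
  The representative \<open>x\<close> of the rightmost child has the same parities at the positions below
  \<open>\<kappa>(n)\<close> and a one at \<open>\<kappa>(n)\<close>. So \<open>2 ^ \<kappa>(n)\<close> divides \<open>x - x'\<close> but
  \<open>2 ^ (\<kappa>(n) + 1)\<close> does not: the quotient of \<open>x - x'\<close> by \<open>2 ^ \<kappa>(n)\<close> is odd, and \<open>\<lambda>\<close> is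
  its residue modulo \<open>2 ^ r\<close>. The bounds on \<open>r\<close> express that \<open>1 < log\<^sub>2 3 < 2\<close>.
\<close>

lemma T_add_even: "T (y + 2 * b) = T y + (if even y then b else 3 * b)"
  unfolding T_def by (auto simp: algebra_simps elim!: evenE oddE)

text \<open>
  The exponent \<open>c\<close> counts the odd iterates among the first \<open>k\<close>; only the oddness
  of \<open>3 ^ c\<close> matters below.
\<close>

lemma T_funpow_shift: "\<exists>c. (T ^^ k) (x + a * 2 ^ k) = (T ^^ k) x + a * 3 ^ c"
proof (induction k arbitrary: a)
  case 0
  show ?case by (intro exI[of _ 0]) simp
next
  case (Suc k)
  obtain c where "(T ^^ k) (x + (2 * a) * 2 ^ k) = (T ^^ k) x + (2 * a) * 3 ^ c"
    using Suc.IH by blast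
  then have "(T ^^ Suc k) (x + a * 2 ^ Suc k) = T ((T ^^ k) x + 2 * (a * 3 ^ c))"
    by (simp add: ac_simps)
  also have "\<dots> = (T ^^ Suc k) x + a * 3 ^ (if even ((T ^^ k) x) then c else Suc c)"
    by (simp add: T_add_even)
  finally show ?case by blast
qed

lemma odd_T_funpow_shift:
  "odd ((T ^^ k) (x + a * 2 ^ k)) \<longleftrightarrow> odd ((T ^^ k) x) \<noteq> odd a"
  using T_funpow_shift[of k x a] by auto

lemma same_parities_iff_dvd:
  "(\<forall>s<L. odd ((T ^^ s) x) = odd ((T ^^ s) y)) \<longleftrightarrow> 2 ^ L dvd x - y"
proof (induction L)
  case 0
  show ?case by simp
next
  case (Suc L)
  show ?case
  proof (cases "2 ^ L dvd x - y")
    case True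
    then obtain a where "x - y = 2 ^ L * a" by (elim dvdE)
    then have x: "x = y + a * 2 ^ L" by (simp add: algebra_simps)
    have "2 ^ Suc L dvd x - y \<longleftrightarrow> even a"
      using x by (simp add: mult.commute)
    moreover have "odd ((T ^^ L) x) = odd ((T ^^ L) y) \<longleftrightarrow> even a"
      using odd_T_funpow_shift[of L y a] x by auto
    ultimately show ?thesis using Suc.IH True by (auto simp: less_Suc_eq)
  next
    case False
    then have "\<not> 2 ^ Suc L dvd x - y" by (metis dvd_mult_right power_Suc)
    then show ?thesis using Suc.IH False by (auto simp: less_Suc_eq)
  qed
qed

text \<open>
  The next parity can be corrected by adding \<open>2 ^ L\<close>, which leaves the first \<open>L\<close> parities
  alone.
\<close>

lemma parities_surj: "\<exists>x. \<forall>s<L. odd ((T ^^ s) x) \<longleftrightarrow> s \<in> S"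
proof (induction L)
  case 0
  show ?case by simp
next
  case (Suc L)
  then obtain x where x: "\<forall>s<L. odd ((T ^^ s) x) \<longleftrightarrow> s \<in> S" by blast
  define a :: int where "a = (if odd ((T ^^ L) x) \<longleftrightarrow> L \<in> S then 0 else 1)"
  have "\<forall>s<L. odd ((T ^^ s) (x + a * 2 ^ L)) = odd ((T ^^ s) x)"
    by (subst same_parities_iff_dvd) simp
  moreover have "odd ((T ^^ L) (x + a * 2 ^ L)) \<longleftrightarrow> L \<in> S"
    unfolding odd_T_funpow_shift a_def by auto
  ultimately show ?case using x by (metis less_Suc_eq)
qed

lemma ones_parity_vector: "ones (parity_vector L x) = {s. s < L \<and> odd ((T ^^ s) x)}"
  unfolding ones_def parity_vector_def by auto

lemma ones_parity_vector_eq_iff: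
  assumes "S \<subseteq> {..<L}"
  shows "ones (parity_vector L x) = S \<longleftrightarrow> (\<forall>s<L. odd ((T ^^ s) x) \<longleftrightarrow> s \<in> S)"
  using assms unfolding ones_parity_vector by auto

text \<open>
  A one at position 0 makes the representative odd, so its residue modulo \<open>2 ^ sigma n\<close> is
  not 0 and does lie in the range from 1 that the definition prescribes.
\<close>

lemma canonical_rep_spec:
  assumes sub: "ones v \<subseteq> {..<sigma n}" and zero: "0 \<in> ones v" and s: "s < sigma n"
  shows "odd ((T ^^ s) (canonical_rep n v)) \<longleftrightarrow> s \<in> ones v"
proof -
  let ?L = "sigma n"
  let ?P = "\<lambda>x. x \<in> {1..2 ^ ?L - 1} \<and> ones (parity_vector ?L x) = ones v"
  obtain y where y: "\<forall>s<?L. odd ((T ^^ s) y) \<longleftrightarrow> s \<in> ones v"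
    using parities_surj by blast
  define z :: int where "z = y mod 2 ^ ?L"
  have "2 ^ ?L dvd z - y"
    unfolding z_def by (simp add: mod_eq_dvd_iff[symmetric])
  with y have z: "\<forall>s<?L. odd ((T ^^ s) z) \<longleftrightarrow> s \<in> ones v"
    unfolding same_parities_iff_dvd[symmetric] by auto
  have "odd ((T ^^ 0) z)" using z zero sub by blast
  then have "z \<noteq> 0" by auto
  moreover have "0 \<le> z" "z < 2 ^ ?L" unfolding z_def by simp_all
  ultimately have "?P z" using z by (simp add: ones_parity_vector_eq_iff[OF sub])
  moreover have "w = z" if "?P w" for w
  proof -
    have "\<forall>s<?L. odd ((T ^^ s) w) = odd ((T ^^ s) z)"
      using that z ones_parity_vector_eq_iff[OF sub] by simp
    then have "2 ^ ?L dvd w - z" by (simp only: same_parities_iff_dvd)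
    then have "w mod 2 ^ ?L = z mod 2 ^ ?L" by (simp add: mod_eq_dvd_iff)
    then show ?thesis using that \<open>?P z\<close> by simp
  qed
  ultimately have "?P (canonical_rep n v)"
    unfolding canonical_rep_def by (rule theI)
  then show ?thesis using s ones_parity_vector_eq_iff[OF sub] by blast
qed

lemma kappa_less_sigma: "kappa n < sigma n"
  using kappa_less[of n] by (simp add: sigma_eq)

lemma canonical_rep_bit_vector:
  assumes a: "\<alpha> \<in> adm_vectors n" and s: "s < sigma n"
  shows "odd ((T ^^ s) (canonical_rep n (bit_vector n \<alpha>))) \<longleftrightarrow> s \<in> set \<alpha>"
proof -
  have sub: "set \<alpha> \<subseteq> {..kappa n}" using adm_vectors_append_kappa(2)[OF a] .
  have ones: "ones (bit_vector n \<alpha>) = set \<alpha>"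
    using sub unfolding ones_def bit_vector_def by (auto simp: less_Suc_eq_le simp del: upt_Suc split: if_splits)
  have "0 \<in> set \<alpha>"
    using a unfolding adm_vectors_def by (auto simp: in_set_conv_nth)
  moreover have "set \<alpha> \<subseteq> {..<sigma n}" using sub kappa_less_sigma[of n] by fastforce
  ultimately show ?thesis using canonical_rep_spec[OF _ _ s] ones by simp
qed

lemma sigma_minus_kappa: "sigma n - kappa n \<in> {2, 3}"
proof -
  have "log 2 3 < log 2 (4::real)" by simp
  also have "log 2 (4::real) = 2" using log_pow_cancel[of "2::real" 2] by simp
  finally have l: "log 2 (3::real) < 2" .
  have "\<lfloor>real (Suc n) * log 2 3\<rfloor> \<le> \<lfloor>real n * log 2 3 + 2\<rfloor>"
    using l by (intro floor_mono) (simp add: algebra_simps)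
  also have "\<dots> = \<lfloor>real n * log 2 3\<rfloor> + 2" by simp
  finally have "kappa (Suc n) \<le> kappa n + 2" unfolding kappa_def by linarith
  then show ?thesis using kappa_less[of n] by (auto simp: sigma_eq)
qed

text \<open>
  An integer multiple \<open>a * m\<close> depends modulo \<open>M * m\<close> only on \<open>a\<close> modulo \<open>M\<close>; for even \<open>M\<close>
  reduction keeps the parity of \<open>a\<close>, and for odd \<open>a\<close> it excludes the residue 0.
\<close>

lemma ex1_odd_residue:
  fixes a :: int
  assumes a: "odd a" and x: "x = y + a * 2 ^ k" and r: "r \<ge> 1"
  shows "\<exists>!l::int. l \<in> {1..2 ^ r - 1} \<and> odd l \<and> [x = y + l * 2 ^ k] (mod 2 ^ (k + r))"
proof -
  have iff: "[x = y + l * 2 ^ k] (mod 2 ^ (k + r)) \<longleftrightarrow> a mod 2 ^ r = l mod 2 ^ r" for l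
  proof -
    have "[x = y + l * 2 ^ k] (mod 2 ^ (k + r)) \<longleftrightarrow> 2 ^ k * 2 ^ r dvd 2 ^ k * (a - l)"
      using x by (simp add: cong_iff_dvd_diff power_add algebra_simps)
    also have "\<dots> \<longleftrightarrow> 2 ^ r dvd a - l" by (subst dvd_mult_cancel_left) simp
    finally show ?thesis by (simp add: mod_eq_dvd_iff)
  qed
  have odd: "odd (a mod 2 ^ r)"
    using a r by (simp add: dvd_mod_iff)
  then have "a mod 2 ^ r \<noteq> 0" by auto
  moreover have "0 \<le> a mod 2 ^ r" "a mod 2 ^ r < 2 ^ r" by simp_all
  ultimately have "a mod 2 ^ r \<in> {1..2 ^ r - 1}" unfolding atLeastAtMost_iff by linarith
  then show ?thesis unfolding iff using odd by (intro ex1I[of _ "a mod 2 ^ r"]) auto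
qed

theorem corollary20:
  fixes n r :: nat and v' v :: "nat list" and x' x :: int
  assumes "n \<ge> 2"
    and "v' \<in> VV (n - 1)"
    and "x' = canonical_rep (n - 1) v'"
    and "v = rightmost_child n v'"
    and "x = canonical_rep n v"
    and "r = sigma n - kappa n"
  shows "[x = x'] (mod 2 ^ kappa n) \<and> r \<in> {2, 3} \<and>
    (\<exists>!l::int. l \<in> {1..2 ^ r - 1} \<and> odd l \<and> [x = x' + l * 2 ^ kappa n] (mod 2 ^ sigma n))"
proof -
  obtain \<alpha> where a: "\<alpha> \<in> adm_vectors (n - 1)" and v': "v' = bit_vector (n - 1) \<alpha>"
    using assms(2) unfolding VV_def by auto
  have sucn: "Suc (n - 1) = n" using assms(1) by simp
  have child: "\<alpha> @ [kappa n] \<in> adm_vectors n"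
    using adm_vectors_append_kappa(1)[OF a] sucn by simp
  have v: "v = bit_vector n (\<alpha> @ [kappa n])"
    using assms(1,4) v' rightmost_child_bit_vector[OF _ a] by simp
  have x': "odd ((T ^^ s) x') \<longleftrightarrow> s \<in> set \<alpha>" if "s \<le> kappa n" for s
    using canonical_rep_bit_vector[OF a, of s] that assms(1,3) v' by (simp add: sigma_eq)
  have x: "odd ((T ^^ s) x) \<longleftrightarrow> s \<in> set \<alpha> \<or> s = kappa n" if "s \<le> kappa n" for s
    using canonical_rep_bit_vector[OF child, of s] that kappa_less_sigma[of n] assms(5) v
    by auto
  have dvd: "2 ^ kappa n dvd x - x'"
    unfolding same_parities_iff_dvd[symmetric] using x x' by simp
  then obtain q where "x - x' = 2 ^ kappa n * q" by (elim dvdE)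
  then have q: "x = x' + q * 2 ^ kappa n" by (simp add: algebra_simps)
  have "kappa n \<notin> set \<alpha>"
    using adm_vectors_append_kappa(2)[OF a] kappa_less[of "n - 1"] sucn by auto
  then have "odd q"
    using x[of "kappa n"] x'[of "kappa n"] odd_T_funpow_shift[of "kappa n" x' q] q by auto
  moreover have r: "r \<in> {2, 3}" using sigma_minus_kappa assms(6) by simp
  moreover have "sigma n = kappa n + r" using kappa_less_sigma[of n] assms(6) by simp
  ultimately show ?thesis
    using ex1_odd_residue[OF _ q, of r] dvd by (auto simp: cong_iff_dvd_diff)
qed

end
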